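(* Let $T,\overline{T}$ be proper binary trees with $n$ internal nodes. Then there is a proper sequence of flips connecting them, i.e. a sequence of binary trees $T=T_0\sim T_1\sim\cdots\sim T_l=\overline{T}$ in which each tree is a flip of the preceding one and every $T_i$ is proper.
   Context: A binary tree is a finite rooted plane tree in which each vertex has either two children, a left child and a right child (such a vertex is internal), or no children (a leaf). Trees are considered up to isomorphism of rooted plane trees. For a vertex $v$ of $T$, $T_v$ denotes the subtree consisting of $v$ and all its descendants; if $v$ is internal, its left and right children are $v',v''$ and $T_v',T_v''$ are the subtrees they generate. Flips: let $v$ be an internal vertex of $T$ and $x$ an internal child of $v$. List left to right the three disjoint subtrees: $T_x',T_x'',T_v''$ if $x=v'$, or $T_v',T_x',T_x''$ if $x=v''$. A binary tree $\overline{T}$ is a flip of $T$, written $T\sim\overline{T}$, if $\overline{T}$ is obtained from $T$ by replacing $T_v$ by another binary tree (with root again called $v$) and there is an internal child $y$ of $v$ in $\overline{T}$ such that the analogous list for $y$ in $\overline{T}$ agrees, entry by entry up to isomorphism, with the list for $x$ in $T$. Proper trees: let $P$ be a convex $(N+2)$-gon drawn with a horizontal top edge, with vertices colored counterclockwise $1,2,1,2,\ldots$ starting at the left endpoint of the top edge. A triangulation of $P$ (a set of pairwise noncrossing chords cutting $P$ into triangles with vertices among those of $P$) is proper if every triangle has both colors among its vertices. There is a standard bijection between triangulations of $P$ and binary trees with $N$ internal vertices: put a tree vertex in every edge of the triangulation (including the edges of $P$), let the vertex in the top edge be the root, connect the root to the vertices in the other two edges of the triangle containing the top edge (the left child being in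 the edge incident to the left endpoint of the top edge), and iterate, using those vertices as roots of subtrees in the subpolygons cut off by those edges. (For $N=0$, $P$ is a single edge, regarded as a proper triangulation of itself, corresponding to the one-vertex tree.) A binary tree is proper if the triangulation corresponding to it under this bijection is proper. *)

theory Defs
  imports "HOL-Library.Tree"
begin

text \<open>Binary trees up to isomorphism of rooted plane trees. A \<open>Node\<close> is an internal vertex (with an
  irrelevant label), so \<^term>\<open>size T\<close> is the number of internal vertices of \<open>T\<close>.\<close>

type_synonym btree = "unit tree"

text \<open>\<open>child_split S xs\<close>: for some internal child \<open>x\<close> of the root \<open>v\<close> of \<open>S\<close>, \<open>xs\<close> is the left-to-right
  list of the three subtrees generated by the children of \<open>x\<close> and by the sibling of \<open>x\<close>.\<close>

inductive child_split :: "btree \<Rightarrow> btree list \<Rightarrow> bool" where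
  left_child: "child_split (Node (Node A () B) () C) [A, B, C]"
| right_child: "child_split (Node A () (Node B () C)) [A, B, C]"

text \<open>In the first rule \<open>S\<close> is the subtree \<open>T\<^sub>v\<close>, replaced by \<open>S'\<close>; the other two rules
  move the place of the replacement from the root to an arbitrary vertex.\<close>

inductive flip :: "btree \<Rightarrow> btree \<Rightarrow> bool" (infix "\<leadsto>" 50) where
  at_root: "child_split S xs \<Longrightarrow> child_split S' xs \<Longrightarrow> S \<noteq> S' \<Longrightarrow> S \<leadsto> S'"
| in_left: "L \<leadsto> L' \<Longrightarrow> Node L () R \<leadsto> Node L' () R"
| in_right: "R \<leadsto> R' \<Longrightarrow> Node L () R \<leadsto> Node L () R'"

text \<open>The vertices of the convex \<open>(N+2)\<close>-gon are numbered \<open>0, \<dots>, N+1\<close> counterclockwise starting at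
  the left endpoint of the top edge. The top edge is therefore \<open>(0, N+1)\<close>.
  A segment between two vertices is the pair \<open>(i, j)\<close> of its endpoints with \<open>i < j\<close>.\<close>

definition vertices :: "nat \<Rightarrow> nat set" where
  "vertices N = {0..N + 1}"

definition color :: "nat \<Rightarrow> nat" where
  "color i = (if even i then 1 else 2)"

text \<open>Sides and diagonals of the convex polygon spanned by a set \<open>F\<close> of vertices: two vertices of \<open>F\<close>
  are cyclically consecutive if no vertex of \<open>F\<close> lies strictly between them, or none lies strictly
  outside.\<close>

definition sides :: "nat set \<Rightarrow> (nat \<times> nat) set" where
  "sides F = {(i, j). i \<in> F \<and> j \<in> F \<and> i < j \<and>
     ((\<forall>k\<in>F. k \<le> i \<or> j \<le> k) \<or> (\<forall>k\<in>F. i \<le> k \<and> k \<le> j))}"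

definition diagonals :: "nat set \<Rightarrow> (nat \<times> nat) set" where
  "diagonals F = {(i, j). i \<in> F \<and> j \<in> F \<and> i < j} - sides F"

text \<open>In a convex polygon two segments meet in their interiors iff their endpoints interleave.\<close>

fun crossing :: "nat \<times> nat \<Rightarrow> nat \<times> nat \<Rightarrow> bool" where
  "crossing (i, j) (k, l) \<longleftrightarrow> (i < k \<and> k < j \<and> j < l) \<or> (k < i \<and> i < l \<and> l < j)"

text \<open>The regions, given by their vertex sets, into which a set \<open>D\<close> of noncrossing chords cuts the
  polygon: polygons bounded by chords of \<open>D\<close> and sides of the big polygon and not cut any further.
  (A chord of \<open>D\<close> entering the interior of such a polygon without being a diagonal
  of it would cross one of its sides.)\<close>

definition region :: "nat \<Rightarrow> (nat \<times> nat) set \<Rightarrow> nat set \<Rightarrow> bool" where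
  "region N D F \<longleftrightarrow> F \<subseteq> vertices N \<and> 3 \<le> card F \<and>
     sides F \<subseteq> sides (vertices N) \<union> D \<and> diagonals F \<inter> D = {}"

definition triangulation :: "nat \<Rightarrow> (nat \<times> nat) set \<Rightarrow> bool" where
  "triangulation N D \<longleftrightarrow> D \<subseteq> diagonals (vertices N) \<and>
     (\<forall>c\<in>D. \<forall>d\<in>D. \<not> crossing c d) \<and> (\<forall>F. region N D F \<longrightarrow> card F = 3)"

text \<open>For \<open>N = 0\<close> there are no regions, so the single edge is a proper triangulation.\<close>

definition proper_triangulation :: "nat \<Rightarrow> (nat \<times> nat) set \<Rightarrow> bool" where
  "proper_triangulation N D \<longleftrightarrow> triangulation N D \<and>
     (\<forall>F. region N D F \<longrightarrow> color ` F = {1, 2})"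

text \<open>\<open>dual_tree N D i j S\<close>: the tree vertex in the edge \<open>(i, j)\<close> generates the subtree \<open>S\<close>, whose
  other vertices lie in the subpolygon with vertices \<open>i, i+1, \<dots>, j\<close> cut off by this edge. An edge
  \<open>(i, i+1)\<close> cuts off nothing.\<close>

inductive dual_tree :: "nat \<Rightarrow> (nat \<times> nat) set \<Rightarrow> nat \<Rightarrow> nat \<Rightarrow> btree \<Rightarrow> bool" for N D where
  side: "dual_tree N D i (Suc i) Leaf"
| triangle: "i < k \<Longrightarrow> k < j \<Longrightarrow> region N D {i, k, j} \<Longrightarrow>
    dual_tree N D i k L \<Longrightarrow> dual_tree N D k j R \<Longrightarrow> dual_tree N D i j (Node L () R)"

definition corresponds :: "nat \<Rightarrow> (nat \<times> nat) set \<Rightarrow> btree \<Rightarrow> bool" where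
  "corresponds N D T \<longleftrightarrow> triangulation N D \<and> dual_tree N D 0 (N + 1) T"

text \<open>By the standard bijection there is exactly one \<open>D\<close> with \<^term>\<open>corresponds (size T) D T\<close>.\<close>

definition proper_tree :: "btree \<Rightarrow> bool" where
  "proper_tree T \<longleftrightarrow> (\<exists>D. corresponds (size T) D T \<and> proper_triangulation (size T) D)"

end

theory Submission
  imports Defs
begin

text \<open>A triangle with vertices \<open>a < k < b\<close> is monochromatic iff \<open>k - a\<close> and \<open>b - k\<close> are both even. In
  the dual tree these differences are one more than the sizes of the two subtrees of the
  corresponding vertex. Hence a tree is proper iff no vertex has two subtrees of odd size
  (\<open>proper_tree_iff\<close>), which removes all geometry from the problem.

  A flip is a rotation \<open>(AB)C \<leftrightarrow> A(BC)\<close>. It changes no size outside the two vertices that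
  it involves, so the above criterion needs checking only there. As flips are reversible, it is
  enough to bring every proper tree to one normal form, the right comb, in which all left subtrees
  are leaves (\<open>proper_flips_to_comb\<close>). By induction both subtrees of the root may be assumed to be
  combs, of sizes \<open>p\<close> and \<open>q\<close>. If \<open>q\<close> is even, rotating the root to the right keeps the tree proper
  and makes its left subtree a leaf, and induction applies to the right subtree. If \<open>q\<close> is odd, then
  \<open>p\<close> is even; if also \<open>p > 0\<close>, that rotation would create a vertex with subtrees of the odd
  sizes \<open>p - 1\<close> and \<open>q\<close>. But now the rotation to the left is allowed; it moves one vertex to the
  left subtree and leaves a comb of even size \<open>q - 1\<close> on the right, which is the previous
  case once the left subtree has again been turned into a comb.\<close>

section \<open>The triangulation dual to a tree\<close>

text \<open>The triangles of the triangulation that \<open>T\<close> describes on the subpolygon \<open>i, \<dots>, i + size T + 1\<close>,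
  as triples of vertices in increasing order. Keeping triangles instead of chords keeps the
  third vertex \<open>k\<close>, which the arguments about regions need.\<close>

fun triangles :: "nat \<Rightarrow> btree \<Rightarrow> (nat \<times> nat \<times> nat) set" where
  "triangles i Leaf = {}"
| "triangles i (Node L u R) =
     insert (i, i + size L + 1, i + size L + size R + 2)
       (triangles i L \<union> triangles (i + size L + 1) R)"

text \<open>The edges that carry an internal tree vertex, the edge of the root included.\<close>

definition chords :: "nat \<Rightarrow> btree \<Rightarrow> (nat \<times> nat) set" where
  "chords i T = {(a, b). \<exists>k. (a, k, b) \<in> triangles i T}"

lemma chords_Leaf [simp]: "chords i Leaf = {}"
  by (simp add: chords_def)

lemma chords_Node [simp]: "chords i (Node L u R) =
    insert (i, i + size L + size R + 2) (chords i L \<union> chords (i + size L + 1) R)"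
  by (auto simp: chords_def)

lemma triangles_bounds:
  "(a, k, b) \<in> triangles i T \<Longrightarrow> i \<le> a \<and> a < k \<and> k < b \<and> b \<le> i + size T + 1"
  by (induction T arbitrary: i) fastforce+

lemma chords_bounds:
  "(a, b) \<in> chords i T \<Longrightarrow> i \<le> a \<and> a + 2 \<le> b \<and> b \<le> i + size T + 1"
  by (auto simp: chords_def dest!: triangles_bounds)

lemma root_chord: "T = Leaf \<or> (i, i + size T + 1) \<in> chords i T"
  by (cases T) auto

lemma triangle_legs:
  assumes "(a, k, b) \<in> triangles i T"
  shows "(k = a + 1 \<or> (a, k) \<in> chords i T) \<and> (b = k + 1 \<or> (k, b) \<in> chords i T)"
  using assms
proof (induction T arbitrary: i)
  case Leaf
  then show ?case by simp
next
  case (Node L u R)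
  consider "(a, k, b) = (i, i + size L + 1, i + size L + size R + 2)"
    | "(a, k, b) \<in> triangles i L" | "(a, k, b) \<in> triangles (i + size L + 1) R"
    using Node.prems by auto
  then show ?case
  proof cases
    case 1
    then show ?thesis
      using root_chord[of L i] root_chord[of R "i + size L + 1"] by auto
  next
    case 2
    then show ?thesis using Node.IH(1) by auto
  next
    case 3
    then show ?thesis using Node.IH(2) by fastforce
  qed
qed

lemma chords_noncrossing:
  "c \<in> chords i T \<Longrightarrow> d \<in> chords i T \<Longrightarrow> \<not> crossing c d"
proof (induction T arbitrary: i)
  case Leaf
  then show ?case by simp
next
  case (Node L u R)
  obtain a b a' b' where cd: "c = (a, b)" "d = (a', b')" by fastforce
  let ?k = "i + size L + 1"
  let ?j = "i + size L + size R + 2"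
  have place: "(x, y) = (i, ?j) \<or>
      (x, y) \<in> chords i L \<and> i \<le> x \<and> x < y \<and> y \<le> ?k \<or>
      (x, y) \<in> chords ?k R \<and> ?k \<le> x \<and> x < y \<and> y \<le> ?j"
    if "(x, y) \<in> chords i (Node L u R)" for x y
    using that chords_bounds[of x y i L] chords_bounds[of x y ?k R] by auto
  show ?case
    using place[OF Node.prems(1)[unfolded cd]] place[OF Node.prems(2)[unfolded cd]]
      Node.IH(1)[of i] Node.IH(2)[of ?k]
    unfolding cd by (elim disjE conjE) auto
qed

text \<open>The chord \<open>(0, size T + 1)\<close> of the root is the top edge of the polygon, not a diagonal.\<close>

definition dual_diagonals :: "btree \<Rightarrow> (nat \<times> nat) set" where
  "dual_diagonals T = chords 0 T - {(0, size T + 1)}"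

lemma sides_vertices_iff:
  "(i, j) \<in> sides (vertices N) \<longleftrightarrow> (j = i + 1 \<and> i \<le> N) \<or> (i = 0 \<and> j = N + 1)"
proof
  assume *: "(i, j) \<in> sides (vertices N)"
  then have ij: "i < j" "j \<le> N + 1" by (auto simp: sides_def vertices_def)
  from * consider "\<forall>k\<in>vertices N. k \<le> i \<or> j \<le> k" | "\<forall>k\<in>vertices N. i \<le> k \<and> k \<le> j"
    by (auto simp: sides_def)
  then show "(j = i + 1 \<and> i \<le> N) \<or> (i = 0 \<and> j = N + 1)"
  proof cases
    case 1
    then have "i + 1 \<le> i \<or> j \<le> i + 1"
      by (rule bspec) (use ij in \<open>auto simp: vertices_def\<close>)
    then show ?thesis using ij by auto
  next
    case 2
    then have "i \<le> 0" "N + 1 \<le> j" by (auto simp: vertices_def)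
    then show ?thesis using ij by auto
  qed
qed (auto simp: sides_def vertices_def)

lemma dual_diagonals_subset: "dual_diagonals T \<subseteq> diagonals (vertices (size T))"
proof
  fix e assume e: "e \<in> dual_diagonals T"
  obtain a b where ab: "e = (a, b)" by fastforce
  have "a + 2 \<le> b" "b \<le> size T + 1" "(a, b) \<noteq> (0, size T + 1)"
    using e chords_bounds[of a b 0 T] by (auto simp: ab dual_diagonals_def)
  then show "e \<in> diagonals (vertices (size T))"
    by (auto simp: ab diagonals_def sides_vertices_iff) (auto simp: vertices_def)
qed

lemma sides_or_dual_diagonals_iff:
  "(a, b) \<in> sides (vertices (size T)) \<union> dual_diagonals T \<longleftrightarrow>
     (b = a + 1 \<and> a \<le> size T) \<or> (a, b) \<in> chords 0 T"
  using root_chord[of T 0] chords_bounds[of a b 0 T]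
  by (auto simp: sides_vertices_iff dual_diagonals_def)

lemma region_triangle:
  assumes t: "(a, k, b) \<in> triangles 0 T"
  shows "region (size T) (dual_diagonals T) {a, k, b}"
proof -
  have bd: "a < k" "k < b" "b \<le> size T + 1" using triangles_bounds[OF t] by auto
  have s: "sides {a, k, b} = {(a, k), (k, b), (a, b)}"
    using bd by (auto simp: sides_def)
  have "(a, b) \<in> chords 0 T" using t by (auto simp: chords_def)
  then have "sides {a, k, b} \<subseteq> sides (vertices (size T)) \<union> dual_diagonals T"
    using triangle_legs[OF t] bd
    unfolding s by (simp add: sides_or_dual_diagonals_iff del: Un_iff)
  moreover have "diagonals {a, k, b} = {}"
    using bd unfolding diagonals_def s by auto
  ultimately show ?thesis
    using bd by (auto simp: region_def vertices_def)
qed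

text \<open>The side \<open>(Min F, Max F)\<close> of a region \<open>F\<close> is a chord of the tree, so a triangle
  \<open>(a, k, b)\<close> of the tree hangs below it, with \<open>a = Min F\<close> and \<open>b = Max F\<close>. The vertex \<open>k\<close> belongs to \<open>F\<close>, because a side
  of \<open>F\<close> that jumps over \<open>k\<close> would cross a leg of the triangle; and \<open>F\<close> has no other vertex, because
  that would make a leg a diagonal of \<open>F\<close>.\<close>

lemma region_is_triangle:
  assumes reg: "region (size T) (dual_diagonals T) F"
  obtains a k b where "(a, k, b) \<in> triangles 0 T" "F = {a, k, b}"
proof -
  let ?N = "size T" and ?D = "dual_diagonals T"
  have card: "3 \<le> card F"
    and Fs: "sides F \<subseteq> sides (vertices ?N) \<union> ?D"
    and Fd: "diagonals F \<inter> ?D = {}"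
    and Fv: "F \<subseteq> vertices ?N"
    using reg by (auto simp: region_def)
  have fin: "finite F" and ne: "F \<noteq> {}"
    using card by (auto intro: card_ge_0_finite)
  define a b where "a = Min F" and "b = Max F"
  have aF: "a \<in> F" and bF: "b \<in> F" and ab: "\<And>x. x \<in> F \<Longrightarrow> a \<le> x \<and> x \<le> b"
    using fin ne by (auto simp: a_def b_def)
  obtain m where m: "m \<in> F" "m \<noteq> a" "m \<noteq> b"
  proof -
    have "\<not> F \<subseteq> {a, b}"
      using card card_mono[of "{a, b}" F] card_insert_le_m1[of 2 "{b}" a] by auto
    then show ?thesis using that by auto
  qed
  then have amb: "a < m" "m < b" using ab[of m] by auto
  have "(a, b) \<in> sides F" using aF bF ab amb by (auto simp: sides_def)
  then have "(a, b) \<in> chords 0 T"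
    using Fs amb sides_or_dual_diagonals_iff[of a b T] by auto
  then obtain k where t: "(a, k, b) \<in> triangles 0 T" by (auto simp: chords_def)
  have akb: "a < k" "k < b" "b \<le> ?N + 1" using triangles_bounds[OF t] by auto
  note legs = triangle_legs[OF t]
  have kF: "k \<in> F"
  proof (rule ccontr)
    assume kF: "k \<notin> F"
    \<comment> \<open>\<open>(p, q)\<close> is the side of \<open>F\<close> that jumps over \<open>k\<close>.\<close>
    define p q where "p = Max {x \<in> F. x < k}" and "q = Min {x \<in> F. k < x}"
    have "p \<in> {x \<in> F. x < k}"
      unfolding p_def by (rule Max_in) (use fin aF akb in auto)
    then have p: "p \<in> F" "p < k" "\<And>x. x \<in> F \<Longrightarrow> x < k \<Longrightarrow> x \<le> p"
      using fin by (auto simp: p_def)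
    have "q \<in> {x \<in> F. k < x}"
      unfolding q_def by (rule Min_in) (use fin bF akb in auto)
    then have q: "q \<in> F" "k < q" "\<And>x. x \<in> F \<Longrightarrow> k < x \<Longrightarrow> q \<le> x"
      using fin by (auto simp: q_def)
    have "\<forall>x\<in>F. x \<le> p \<or> q \<le> x"
      using p(3) q(3) kF by (metis linorder_neqE_nat)
    then have "(p, q) \<in> sides F" using p q by (auto simp: sides_def)
    then have pq: "(p, q) \<in> chords 0 T"
      using Fs p(2) q(2) sides_or_dual_diagonals_iff[of p q T] by auto
    \<comment> \<open>Otherwise this side would be the longest one, and \<open>F\<close> would have no third vertex \<open>m\<close>.\<close>
    have "p \<noteq> a \<or> q \<noteq> b"
      using m amb \<open>\<forall>x\<in>F. x \<le> p \<or> q \<le> x\<close> by force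
    then consider "a < p" | "p = a" "q < b"
      using ab[OF p(1)] ab[OF q(1)] by force
    then show False
    proof cases
      case 1
      then have "(a, k) \<in> chords 0 T" using legs p(2) by auto
      from chords_noncrossing[OF this pq] show False using 1 p(2) q(2) by simp
    next
      case 2
      then have "(k, b) \<in> chords 0 T" using legs q(2) by auto
      from chords_noncrossing[OF pq this] show False using 2 p(2) q(2) by simp
    qed
  qed
  have "x \<in> {a, k, b}" if x: "x \<in> F" for x
  proof (rule ccontr)
    assume "x \<notin> {a, k, b}"
    then consider "a < x" "x < k" | "k < x" "x < b" using ab[OF x] by force
    then show False
    proof cases
      case 1
      then have "(a, k) \<in> ?D"
        using legs akb by (auto simp: dual_diagonals_def)
      moreover have "(a, k) \<in> diagonals F"
      proof -
        have "\<not> (x \<le> a \<or> k \<le> x)" "\<not> (a \<le> b \<and> b \<le> k)" using 1 akb by auto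
        then show ?thesis using aF kF bF x akb unfolding diagonals_def sides_def by blast
      qed
      ultimately show False using Fd by auto
    next
      case 2
      then have "(k, b) \<in> ?D"
        using legs akb by (auto simp: dual_diagonals_def)
      moreover have "(k, b) \<in> diagonals F"
      proof -
        have "\<not> (x \<le> k \<or> b \<le> x)" "\<not> (k \<le> a \<and> a \<le> b)" using 2 akb by auto
        then show ?thesis using aF kF bF x akb unfolding diagonals_def sides_def by blast
      qed
      ultimately show False using Fd by auto
    qed
  qed
  then have "F = {a, k, b}" using aF kF bF by auto
  with t that show ?thesis by blast
qed

lemma triangulation_dual_diagonals: "triangulation (size T) (dual_diagonals T)"
proof -
  have "card F = 3" if F: "region (size T) (dual_diagonals T) F" for F
  proof -
    obtain a k b where *: "(a, k, b) \<in> triangles 0 T" "F = {a, k, b}"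
      by (rule region_is_triangle[OF F])
    then show ?thesis using triangles_bounds[OF *(1)] by auto
  qed
  moreover have "\<forall>c\<in>dual_diagonals T. \<forall>d\<in>dual_diagonals T. \<not> crossing c d"
    unfolding dual_diagonals_def using chords_noncrossing by blast
  ultimately show ?thesis
    using dual_diagonals_subset by (auto simp: triangulation_def)
qed

lemma dual_tree_dual_diagonals:
  "triangles i S \<subseteq> triangles 0 T \<Longrightarrow>
     dual_tree (size T) (dual_diagonals T) i (i + size S + 1) S"
proof (induction S arbitrary: i)
  case Leaf
  then show ?case by (simp add: dual_tree.side)
next
  case (Node L u R)
  let ?k = "i + size L + 1" and ?j = "i + size L + size R + 2"
  have "dual_tree (size T) (dual_diagonals T) i ?k L"
    using Node.IH(1)[of i] Node.prems by simp
  moreover have "dual_tree (size T) (dual_diagonals T) ?k ?j R"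
    using Node.IH(2)[of ?k] Node.prems by simp
  moreover have "region (size T) (dual_diagonals T) {i, ?k, ?j}"
    using Node.prems by (intro region_triangle) auto
  ultimately have "dual_tree (size T) (dual_diagonals T) i ?j (Node L () R)"
    by (intro dual_tree.triangle) auto
  then show ?case by (simp add: add.assoc)
qed

lemma corresponds_dual_diagonals: "corresponds (size T) (dual_diagonals T) T"
  using triangulation_dual_diagonals dual_tree_dual_diagonals[of 0 T T]
  by (simp add: corresponds_def)

section \<open>Properness in terms of subtree sizes\<close>

fun parity_proper :: "btree \<Rightarrow> bool" where
  "parity_proper Leaf \<longleftrightarrow> True"
| "parity_proper (Node L u R) \<longleftrightarrow>
     parity_proper L \<and> parity_proper R \<and> (even (size L) \<or> even (size R))"

lemma bichromatic_iff:
  "color ` {i, i + l + 1, i + l + r + 2} = {1, 2} \<longleftrightarrow> even l \<or> even r"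
  by (cases "even i"; cases "even l"; cases "even r")
    (simp_all add: color_def insert_commute doubleton_eq_iff)

lemma dual_tree_size: "dual_tree N D i j S \<Longrightarrow> j = i + size S + 1"
  by (induction rule: dual_tree.induct) auto

lemma dual_tree_parity_proper:
  assumes "dual_tree N D i j S" and "\<And>F. region N D F \<Longrightarrow> color ` F = {1, 2}"
  shows "parity_proper S"
  using assms(1)
proof (induction rule: dual_tree.induct)
  case (side i)
  then show ?case by simp
next
  case (triangle i k j L R)
  have "k = i + size L + 1" "j = i + size L + size R + 2"
    using triangle.hyps(4,5) by (auto dest!: dual_tree_size)
  then have "even (size L) \<or> even (size R)"
    using assms(2)[OF triangle.hyps(3)] bichromatic_iff by metis
  then show ?case using triangle.IH by simp
qed

lemma parity_proper_triangle:
  "parity_proper T \<Longrightarrow> (a, k, b) \<in> triangles i T \<Longrightarrow> color ` {a, k, b} = {1, 2}"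
proof (induction T arbitrary: i)
  case Leaf
  then show ?case by simp
next
  case (Node L u R)
  consider "(a, k, b) = (i, i + size L + 1, i + size L + size R + 2)"
    | "(a, k, b) \<in> triangles i L" | "(a, k, b) \<in> triangles (i + size L + 1) R"
    using Node.prems by auto
  then show ?case
  proof cases
    case 1
    then show ?thesis
      using Node.prems bichromatic_iff[of i "size L" "size R"]
      by (simp only: prod.inject parity_proper.simps)
  next
    case 2
    then show ?thesis using Node by simp
  next
    case 3
    then show ?thesis using Node by simp
  qed
qed

lemma proper_tree_iff: "proper_tree T \<longleftrightarrow> parity_proper T"
proof
  assume "proper_tree T"
  then show "parity_proper T"
    unfolding proper_tree_def corresponds_def proper_triangulation_def
    using dual_tree_parity_proper by blast
next
  assume T: "parity_proper T"
  have "color ` F = {1, 2}" if "region (size T) (dual_diagonals T) F" for F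
    using region_is_triangle[OF that] parity_proper_triangle[OF T] by metis
  then show "proper_tree T"
    using corresponds_dual_diagonals[of T]
    by (auto simp: proper_tree_def proper_triangulation_def corresponds_def)
qed

section \<open>Flipping to the right comb\<close>

lemma flip_size: "S \<leadsto> S' \<Longrightarrow> size S' = size S"
  by (induction rule: flip.induct) (auto elim!: child_split.cases)

lemma flip_sym: "S \<leadsto> S' \<Longrightarrow> S' \<leadsto> S"
  by (induction rule: flip.induct) (auto intro: flip.intros)

lemma rotation_flip: "Node (Node A () B) () C \<leadsto> Node A () (Node B () C)"
proof -
  have "A \<noteq> Node A () B"
    using size_neq_size_imp_neq[of A "Node A () B"] by simp
  then show ?thesis
    by (intro flip.at_root[of _ "[A, B, C]"] child_split.intros) auto
qed

definition proper_flip :: "btree \<Rightarrow> btree \<Rightarrow> bool" where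
  "proper_flip S S' \<longleftrightarrow> S \<leadsto> S' \<and> parity_proper S \<and> parity_proper S'"

lemma proper_flip_sym: "symp proper_flip"
  by (auto simp: symp_def proper_flip_def flip_sym)

lemma proper_flips_left:
  assumes "proper_flip\<^sup>*\<^sup>* L L'" and "parity_proper (Node L () R)"
  shows "proper_flip\<^sup>*\<^sup>* (Node L () R) (Node L' () R)"
proof -
  have "proper_flip\<^sup>*\<^sup>* (Node L () R) (Node L' () R) \<and> size L' = size L"
    using assms
  proof (induction rule: rtranclp_induct)
    case base
    then show ?case by simp
  next
    case (step M M')
    then have "proper_flip (Node M () R) (Node M' () R)" "size M' = size L"
      by (auto simp: proper_flip_def flip_size intro: flip.in_left)
    with step show ?case by (auto intro: rtranclp.rtrancl_into_rtrancl)
  qed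
  then show ?thesis by simp
qed

lemma proper_flips_right:
  assumes "proper_flip\<^sup>*\<^sup>* R R'" and "parity_proper (Node L () R)"
  shows "proper_flip\<^sup>*\<^sup>* (Node L () R) (Node L () R')"
proof -
  have "proper_flip\<^sup>*\<^sup>* (Node L () R) (Node L () R') \<and> size R' = size R"
    using assms
  proof (induction rule: rtranclp_induct)
    case base
    then show ?case by simp
  next
    case (step M M')
    then have "proper_flip (Node L () M) (Node L () M')" "size M' = size R"
      by (auto simp: proper_flip_def flip_size intro: flip.in_right)
    with step show ?case by (auto intro: rtranclp.rtrancl_into_rtrancl)
  qed
  then show ?thesis by simp
qed

fun comb :: "nat \<Rightarrow> btree" where
  "comb 0 = Leaf"
| "comb (Suc n) = Node Leaf () (comb n)"

lemma size_comb [simp]: "size (comb n) = n"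
  by (induction n) auto

lemma parity_proper_comb [simp]: "parity_proper (comb n)"
  by (induction n) auto

text \<open>The induction is on the size rather than on the structure of \<open>T\<close>, because the hypothesis is also
  applied to trees that arise from rotations and are not subtrees of \<open>T\<close>.\<close>

lemma proper_flips_to_comb:
  "parity_proper T \<Longrightarrow> proper_flip\<^sup>*\<^sup>* T (comb (size T))"
proof (induction T rule: measure_induct_rule[of size])
  case (less T)
  show ?case
  proof (cases T)
    case Leaf
    then show ?thesis by simp
  next
    case (Node L u R)
    have T: "T = Node L () R" using Node by simp
    have even_case: "proper_flip\<^sup>*\<^sup>* (Node (comb p) () (comb q)) (comb (size T))"
      if "even q" and pq: "p + q + 1 = size T" for p q
    proof (cases p)
      case 0
      then have "Node (comb p) () (comb q) = comb (size T)"
        using pq by (simp flip: pq)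
      then show ?thesis by simp
    next
      case (Suc p')
      let ?M = "Node (comb p') () (comb q)"
      have M: "parity_proper ?M" "size ?M < size T" "size T = Suc (size ?M)"
        using \<open>even q\<close> pq Suc by auto
      have "proper_flip (Node (comb p) () (comb q)) (Node Leaf () ?M)"
        using \<open>even q\<close> Suc rotation_flip[of Leaf "comb p'" "comb q"]
        by (simp add: proper_flip_def)
      also have "proper_flip\<^sup>*\<^sup>* (Node Leaf () ?M) (Node Leaf () (comb (size ?M)))"
        using M less.IH[of ?M] by (intro proper_flips_right) auto
      also have "Node Leaf () (comb (size ?M)) = comb (size T)"
        using M(3) by (simp only: comb.simps)
      finally show ?thesis .
    qed
    define p q where "p = size L" and "q = size R"
    have par: "even p \<or> even q" and pq: "p + q + 1 = size T"
      using less.prems by (auto simp: T p_def q_def)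
    have "proper_flip\<^sup>*\<^sup>* T (Node (comb p) () R)"
      using less.IH[of L] less.prems by (auto simp: T p_def intro: proper_flips_left)
    also have "proper_flip\<^sup>*\<^sup>* (Node (comb p) () R) (Node (comb p) () (comb q))"
      using less.IH[of R] less.prems by (auto simp: T p_def q_def intro: proper_flips_right)
    also have "proper_flip\<^sup>*\<^sup>* (Node (comb p) () (comb q)) (comb (size T))"
    proof (cases "even q")
      case True
      then show ?thesis using even_case pq by blast
    next
      case False
      then have "even p" using par by simp
      obtain q' where q': "q = Suc q'" "even q'" using False by (cases q) auto
      \<comment> \<open>The right subtree is \<open>comb q = Node Leaf () (comb q')\<close>. Rotating to the left, the three
        subtrees involved have the even sizes \<open>p, 0, q'\<close>; \<open>?M\<close> is the new left subtree.\<close>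
      let ?M = "Node (comb p) () Leaf"
      have M: "parity_proper ?M" "size ?M < size T" "size ?M = p + 1"
        using pq q' by auto
      have "proper_flip (Node (comb p) () (comb q)) (Node ?M () (comb q'))"
        using \<open>even p\<close> q' flip_sym[OF rotation_flip[of "comb p" Leaf "comb q'"]]
        by (simp add: proper_flip_def)
      also have "proper_flip\<^sup>*\<^sup>* (Node ?M () (comb q')) (Node (comb (p + 1)) () (comb q'))"
        using M less.IH[of ?M] q' by (intro proper_flips_left) auto
      also have "proper_flip\<^sup>*\<^sup>* (Node (comb (p + 1)) () (comb q')) (comb (size T))"
        using even_case[of q' "p + 1"] q' pq by simp
      finally show ?thesis .
    qed
    finally show ?thesis .
  qed
qed

section \<open>Connectedness under proper flips\<close>

theorem theorem4p3:
  fixes T T' :: btree and n :: nat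
  assumes "proper_tree T" and "proper_tree T'"
    and "size T = n" and "size T' = n"
  shows "\<exists>(l :: nat) (S :: nat \<Rightarrow> btree). S 0 = T \<and> S l = T' \<and>
    (\<forall>i<l. S i \<leadsto> S (Suc i)) \<and> (\<forall>i\<le>l. proper_tree (S i))"
proof -
  have "proper_flip\<^sup>*\<^sup>* T (comb n)" "proper_flip\<^sup>*\<^sup>* T' (comb n)"
    using assms proper_flips_to_comb[of T] proper_flips_to_comb[of T'] by (auto simp: proper_tree_iff)
  then have "proper_flip\<^sup>*\<^sup>* T T'"
    using proper_flip_sym by (metis symp_rtranclp sympD rtranclp_trans)
  then obtain l where "(proper_flip ^^ l) T T'"
    by (auto simp: rtranclp_power)
  then obtain S where S: "S 0 = T" "S l = T'" "\<forall>i<l. proper_flip (S i) (S (Suc i))"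
    by (auto simp: relpowp_fun_conv)
  have "proper_tree (S i)" if "i \<le> l" for i
  proof (cases i)
    case 0
    then show ?thesis using S assms by simp
  next
    case (Suc i')
    then show ?thesis using S(3) that by (auto simp: proper_flip_def proper_tree_iff)
  qed
  then show ?thesis using S by (auto simp: proper_flip_def)
qed

end
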